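(* Let $d\ge1$ and $t\ge 1$ be integers, let $\gamma$ be a $2t$-design curve in $\mathbb{S}^d$, and let $f\in\Pi_t$ be a polynomial of degree at most $t$. Then $$\frac{1}{\ell(\gamma)}\int_\gamma|f|^2=\int_{\mathbb{S}^d}|f|^2 .$$ Furthermore, $f$ as a function on $\mathbb{S}^d$ is uniquely determined by its values along $\gamma$: if $f,g\in\Pi_t$ coincide on $\gamma([0,1])$, then $f=g$ on $\mathbb{S}^d$.
   Context: $\mathbb{S}^d=\{x\in\mathbb{R}^{d+1}:\|x\|=1\}$, and $\int_{\mathbb{S}^d}$ denotes integration with respect to the surface measure normalized so that $\int_{\mathbb{S}^d}1=1$. $\Pi_t$ is the space of algebraic polynomials (real or complex coefficients) in $d+1$ real variables of total degree at most $t$. A curve is a continuous, piecewise smooth map $\gamma:[0,1]\to\mathbb{S}^d$ with at most finitely many self-intersections (all but finitely many points of $\gamma([0,1))$ are attained exactly once on $[0,1)$); all curves are closed, i.e. $\gamma(0)=\gamma(1)$. Its length is $\ell(\gamma)=\int_0^1\|\dot\gamma(s)\|\,ds$, assumed positive, and $\int_\gamma f=\int_0^1 f(\gamma(s))\|\dot\gamma(s)\|\,ds$. For a positive integer $m$, a curve $\gamma$ is an $m$-design curve in $\mathbb{S}^d$ if $\frac{1}{\ell(\gamma)}\int_\gamma f=\int_{\mathbb{S}^d}f$ for all $f\in\Pi_m$. *)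

theory Defs
  imports "HOL-Analysis.Analysis"
begin

text \<open>Functions on \<open>\<real>\<^sup>n\<close> given by polynomials of total degree at most \<open>t\<close>, with
  multi-indices \<open>\<alpha>\<close>. Polynomials with real coefficients are the case where all \<open>c \<alpha>\<close> are real.\<close>

definition poly_space :: "nat \<Rightarrow> (real ^ 'n \<Rightarrow> complex) set" where
  "poly_space t = {f. \<exists>c :: ('n \<Rightarrow> nat) \<Rightarrow> complex. \<forall>x.
     f x = (\<Sum>\<alpha> | (\<Sum>i\<in>UNIV. \<alpha> i) \<le> t. c \<alpha> * of_real (\<Prod>i\<in>UNIV. (x $ i) ^ \<alpha> i))}"

lemma finite_multi_indices: "finite {\<alpha> :: 'n::finite \<Rightarrow> nat. (\<Sum>i\<in>UNIV. \<alpha> i) \<le> t}"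
proof (rule finite_subset)
  show "{\<alpha> :: 'n \<Rightarrow> nat. (\<Sum>i\<in>UNIV. \<alpha> i) \<le> t} \<subseteq> (\<Pi>\<^sub>E i\<in>UNIV. {..t})"
  proof
    fix \<alpha> :: "'n \<Rightarrow> nat" assume "\<alpha> \<in> {\<alpha>. (\<Sum>i\<in>UNIV. \<alpha> i) \<le> t}"
    then have "\<alpha> i \<le> t" for i
      using member_le_sum[of i UNIV \<alpha>] by simp
    then show "\<alpha> \<in> (\<Pi>\<^sub>E i\<in>UNIV. {..t})"
      by (simp add: PiE_UNIV_domain)
  qed
  show "finite (\<Pi>\<^sub>E i\<in>(UNIV :: 'n set). {..t})"
    by (intro finite_PiE) auto
qed

text \<open>Surface measure on the unit sphere, defined through polar coordinates: a Borel set \<open>E\<close> of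
  the sphere has measure \<open>n \<cdot> vol {x. 0 < \<parallel>x\<parallel> \<le> 1 \<and> x / \<parallel>x\<parallel> \<in> E}\<close>, where \<open>n\<close> is the dimension of
  the ambient space.\<close>

definition surface_measure :: "'a::euclidean_space measure" where
  "surface_measure = scale_measure (of_nat DIM('a))
     (distr (restrict_space lborel (cball 0 1 - {0})) (restrict_space borel (sphere 0 1))
       (\<lambda>x. x /\<^sub>R norm x))"

lemma measurable_sphere_projection:
  "(\<lambda>x :: 'a::euclidean_space. x /\<^sub>R norm x)
     \<in> restrict_space lborel (cball 0 1 - {0}) \<rightarrow>\<^sub>M restrict_space borel (sphere 0 1)"
  by (rule measurable_restrict_space2) (auto simp: space_restrict_space intro!: measurable_restrict_space1)

lemma space_surface_measure: "space (surface_measure :: 'a::euclidean_space measure) = sphere 0 1"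
  by (simp add: surface_measure_def space_scale_measure space_restrict_space)

lemma emeasure_surface_measure:
  fixes E :: "'a::euclidean_space set"
  assumes "E \<in> sets borel" "E \<subseteq> sphere 0 1"
  shows "emeasure surface_measure E =
    of_nat DIM('a) * emeasure lborel {x. 0 < norm x \<and> norm x \<le> 1 \<and> x /\<^sub>R norm x \<in> E}"
proof -
  have E: "E \<in> sets (restrict_space borel (sphere 0 1))"
    using assms by (auto simp: sets_restrict_space_iff)
  have eq: "(\<lambda>x. x /\<^sub>R norm x) -` E \<inter> (cball 0 1 - {0}) =
      {x. 0 < norm x \<and> norm x \<le> 1 \<and> x /\<^sub>R norm x \<in> E}"
    by auto
  have "emeasure (restrict_space lborel (cball 0 1 - {0}))
      {x :: 'a. 0 < norm x \<and> norm x \<le> 1 \<and> x /\<^sub>R norm x \<in> E} =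
    emeasure lborel {x. 0 < norm x \<and> norm x \<le> 1 \<and> x /\<^sub>R norm x \<in> E}"
    by (rule emeasure_restrict_space) auto
  then show ?thesis
    by (simp add: surface_measure_def emeasure_distr[OF measurable_sphere_projection E]
        space_restrict_space eq del: zero_less_norm_iff)
qed

definition sphere_integral ::
    "('a::euclidean_space \<Rightarrow> 'b::{banach, second_countable_topology}) \<Rightarrow> 'b" where
  "sphere_integral f =
     (LINT x|surface_measure. f x) /\<^sub>R measure surface_measure (sphere 0 1 :: 'a set)"

definition curve_length :: "(real \<Rightarrow> 'a::real_normed_vector) \<Rightarrow> real" where
  "curve_length \<gamma> = integral {0..1} (\<lambda>s. norm (vector_derivative \<gamma> (at s within {0..1})))"

definition curve_integral :: "(real \<Rightarrow> 'a::real_normed_vector) \<Rightarrow> ('a \<Rightarrow> 'b::banach) \<Rightarrow> 'b" where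
  "curve_integral \<gamma> f =
     integral {0..1} (\<lambda>s. norm (vector_derivative \<gamma> (at s within {0..1})) *\<^sub>R f (\<gamma> s))"

text \<open>\<open>valid_path\<close> is continuity together with piecewise continuous differentiability on \<open>[0,1]\<close>.
  It does not force the speed to be integrable; but the integral of a non-integrable function is
  \<open>0\<close>, so positivity of the length includes its finiteness.\<close>

definition closed_sphere_curve :: "(real \<Rightarrow> 'a::euclidean_space) \<Rightarrow> bool" where
  "closed_sphere_curve \<gamma> \<longleftrightarrow>
     valid_path \<gamma> \<and> path_image \<gamma> \<subseteq> sphere 0 1 \<and> pathfinish \<gamma> = pathstart \<gamma> \<and>
     finite {p \<in> \<gamma> ` {0..<1}. \<not> (\<exists>!s. s \<in> {0..<1} \<and> \<gamma> s = p)} \<and>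
     0 < curve_length \<gamma>"

definition design_curve :: "nat \<Rightarrow> (real \<Rightarrow> real ^ 'n) \<Rightarrow> bool" where
  "design_curve m \<gamma> \<longleftrightarrow> closed_sphere_curve \<gamma> \<and>
     (\<forall>f \<in> poly_space m. curve_integral \<gamma> f /\<^sub>R curve_length \<gamma> = sphere_integral f)"

end

theory Submission
  imports Defs
begin

text \<open>The function \<open>|f|\<^sup>2 = f \<cdot> cnj f\<close> is itself a polynomial of degree at most
  \<open>2t\<close> (\<open>poly_space_norm_square\<close>), so the design property applies to it and gives the
  identity of the two means. For the second claim take \<open>h = f - g\<close>, again in the space of degree
  \<open>t\<close>. If \<open>h\<close> vanishes on the curve, then the mean of \<open>|h|\<^sup>2\<close> over the curve is zero, hence by the
  first claim the mean of \<open>|h|\<^sup>2\<close> over the sphere is zero. A nonnegative continuous function with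
  zero mean vanishes, because every nonempty relatively open subset of the sphere has positive
  surface measure (\<open>sphere_integral_eq_0_imp_eq_0\<close>).\<close>

section \<open>Algebra of polynomial functions\<close>

lemma monomial_in_poly_space:
  fixes \<alpha> :: "'n::finite \<Rightarrow> nat"
  assumes "(\<Sum>i\<in>UNIV. \<alpha> i) \<le> t"
  shows "(\<lambda>x :: real ^ 'n. of_real (\<Prod>i\<in>UNIV. (x $ i) ^ \<alpha> i)) \<in> poly_space t"
  unfolding poly_space_def
proof (intro CollectI exI allI)
  fix x :: "real ^ 'n"
  show "of_real (\<Prod>i\<in>UNIV. (x $ i) ^ \<alpha> i) =
    (\<Sum>\<beta> | (\<Sum>i\<in>UNIV. \<beta> i) \<le> t.
      of_bool (\<beta> = \<alpha>) * complex_of_real (\<Prod>i\<in>UNIV. (x $ i) ^ \<beta> i))"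
    using assms by (subst sum.mono_neutral_right[where S = "{\<alpha>}"]) (auto simp: finite_multi_indices)
qed

lemma poly_space_cmult:
  assumes "f \<in> poly_space t"
  shows "(\<lambda>x. a * f x) \<in> poly_space t"
proof -
  from assms obtain c where c: "\<And>x. f x =
      (\<Sum>\<alpha> | (\<Sum>i\<in>UNIV. \<alpha> i) \<le> t. c \<alpha> * of_real (\<Prod>i\<in>UNIV. (x $ i) ^ \<alpha> i))"
    by (auto simp: poly_space_def)
  show ?thesis
    unfolding poly_space_def
    by (rule CollectI, rule exI[of _ "\<lambda>\<alpha>. a * c \<alpha>"]) (simp add: c sum_distrib_left mult.assoc)
qed

lemma poly_space_add:
  assumes "f \<in> poly_space t" "g \<in> poly_space t"
  shows "(\<lambda>x. f x + g x) \<in> poly_space t"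
proof -
  from assms obtain c d where c: "\<And>x. f x =
      (\<Sum>\<alpha> | (\<Sum>i\<in>UNIV. \<alpha> i) \<le> t. c \<alpha> * of_real (\<Prod>i\<in>UNIV. (x $ i) ^ \<alpha> i))"
    and d: "\<And>x. g x =
      (\<Sum>\<alpha> | (\<Sum>i\<in>UNIV. \<alpha> i) \<le> t. d \<alpha> * of_real (\<Prod>i\<in>UNIV. (x $ i) ^ \<alpha> i))"
    by (auto simp: poly_space_def)
  show ?thesis
    unfolding poly_space_def
    by (rule CollectI, rule exI[of _ "\<lambda>\<alpha>. c \<alpha> + d \<alpha>"])
       (simp add: c d sum.distrib ring_distribs)
qed

lemma poly_space_diff:
  assumes "f \<in> poly_space t" "g \<in> poly_space t"
  shows "(\<lambda>x. f x - g x) \<in> poly_space t"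
  using poly_space_add[OF assms(1) poly_space_cmult[OF assms(2), of "-1"]] by simp

lemma poly_space_sum:
  assumes "\<And>i. i \<in> A \<Longrightarrow> f i \<in> poly_space t"
  shows "(\<lambda>x. \<Sum>i\<in>A. f i x) \<in> poly_space t"
  using assms
proof (induction A rule: infinite_finite_induct)
  case (insert i A)
  then show ?case by (simp add: poly_space_add)
qed (auto simp: poly_space_def intro!: exI[of _ "\<lambda>_. 0"])

lemma poly_space_cnj:
  assumes "f \<in> poly_space t"
  shows "(\<lambda>x. cnj (f x)) \<in> poly_space t"
proof -
  from assms obtain c where c: "\<And>x. f x =
      (\<Sum>\<alpha> | (\<Sum>i\<in>UNIV. \<alpha> i) \<le> t. c \<alpha> * of_real (\<Prod>i\<in>UNIV. (x $ i) ^ \<alpha> i))"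
    by (auto simp: poly_space_def)
  show ?thesis
    unfolding poly_space_def
    by (rule CollectI, rule exI[of _ "\<lambda>\<alpha>. cnj (c \<alpha>)"])
       (simp add: c del: of_real_prod of_real_power)
qed

text \<open>The expanded product is a double sum of monomials with exponents \<open>\<alpha> + \<beta>\<close>. Closure of the space
  under finite sums spares the collection of equal exponents into a single coefficient.\<close>

lemma poly_space_mult:
  fixes f g :: "real ^ 'n \<Rightarrow> complex"
  assumes "f \<in> poly_space s" "g \<in> poly_space t"
  shows "(\<lambda>x. f x * g x) \<in> poly_space (s + t)"
proof -
  let ?m = "\<lambda>\<alpha> (x :: real ^ 'n). complex_of_real (\<Prod>i\<in>UNIV. (x $ i) ^ \<alpha> i)"
  from assms obtain c d where c: "\<And>x. f x = (\<Sum>\<alpha> | (\<Sum>i\<in>UNIV. \<alpha> i) \<le> s. c \<alpha> * ?m \<alpha> x)"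
    and d: "\<And>x. g x = (\<Sum>\<alpha> | (\<Sum>i\<in>UNIV. \<alpha> i) \<le> t. d \<alpha> * ?m \<alpha> x)"
    by (auto simp: poly_space_def)
  have "?m \<alpha> x * ?m \<beta> x = ?m (\<lambda>i. \<alpha> i + \<beta> i) x" for \<alpha> \<beta> x
    by (simp add: power_add prod.distrib)
  then have "(\<lambda>x. f x * g x) = (\<lambda>x. \<Sum>\<alpha> | (\<Sum>i\<in>UNIV. \<alpha> i) \<le> s. \<Sum>\<beta> | (\<Sum>i\<in>UNIV. \<beta> i) \<le> t.
      (c \<alpha> * d \<beta>) * ?m (\<lambda>i. \<alpha> i + \<beta> i) x)"
    by (simp add: c d sum_product mult_ac del: of_real_prod of_real_power)
  also have "\<dots> \<in> poly_space (s + t)"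
    by (intro poly_space_sum poly_space_cmult monomial_in_poly_space)
       (auto simp: sum.distrib intro: add_mono)
  finally show ?thesis .
qed

lemma poly_space_norm_square:
  assumes "f \<in> poly_space t"
  shows "(\<lambda>x. complex_of_real ((cmod (f x))\<^sup>2)) \<in> poly_space (2 * t)"
  using poly_space_mult[OF assms poly_space_cnj[OF assms]]
  by (simp only: complex_norm_square mult_2)

lemma continuous_on_poly_space:
  assumes "f \<in> poly_space t"
  shows "continuous_on S f"
proof -
  from assms obtain c where "f = (\<lambda>x.
      \<Sum>\<alpha> | (\<Sum>i\<in>UNIV. \<alpha> i) \<le> t. c \<alpha> * of_real (\<Prod>i\<in>UNIV. (x $ i) ^ \<alpha> i))"
    by (auto simp: poly_space_def)
  then show ?thesis
    by (auto intro!: continuous_intros)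
qed

section \<open>Real integrands as complex ones\<close>

text \<open>The design property speaks of complex-valued integrands, while \<open>|f|\<^sup>2\<close> is real-valued. A real
  integrand and its complexification are integrable at the same time, the real part map giving one
  direction, and both integrals are zero by convention when they are not integrable.\<close>

lemma curve_integral_of_real:
  "curve_integral \<gamma> (\<lambda>x. complex_of_real (h x)) = of_real (curve_integral \<gamma> h)"
proof -
  define k where "k s = norm (vector_derivative \<gamma> (at s within {0..1})) * h (\<gamma> s)" for s
  have "integral {0..1} (\<lambda>s. complex_of_real (k s)) = of_real (integral {0..1} k)"
  proof (cases "k integrable_on {0..1}")
    case True
    from integral_linear[OF this bounded_linear_of_real[where 'a = complex]] show ?thesis
      by (simp add: o_def)
  next
    case False
    have "\<not> (\<lambda>s. complex_of_real (k s)) integrable_on {0..1}"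
    proof
      assume "(\<lambda>s. complex_of_real (k s)) integrable_on {0..1}"
      from integrable_linear[OF this bounded_linear_Re] False show False
        by (simp add: o_def)
    qed
    with False show ?thesis
      by (simp add: not_integrable_integral)
  qed
  then show ?thesis
    by (simp add: curve_integral_def k_def[abs_def] scaleR_conv_of_real)
qed

lemma sphere_integral_of_real:
  "sphere_integral (\<lambda>x. complex_of_real (h x)) = of_real (sphere_integral h)"
  by (simp add: sphere_integral_def scaleR_conv_of_real)

lemma design_curve_norm_square:
  assumes "design_curve (2 * t) \<gamma>" "f \<in> poly_space t"
  shows "curve_integral \<gamma> (\<lambda>x. (cmod (f x))\<^sup>2) / curve_length \<gamma> = sphere_integral (\<lambda>x. (cmod (f x))\<^sup>2)"
proof -
  have "curve_integral \<gamma> (\<lambda>x. complex_of_real ((cmod (f x))\<^sup>2)) /\<^sub>R curve_length \<gamma> =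
      sphere_integral (\<lambda>x. complex_of_real ((cmod (f x))\<^sup>2))"
    using assms poly_space_norm_square by (auto simp: design_curve_def simp del: of_real_power)
  then have "complex_of_real (curve_integral \<gamma> (\<lambda>x. (cmod (f x))\<^sup>2) / curve_length \<gamma>) =
      of_real (sphere_integral (\<lambda>x. (cmod (f x))\<^sup>2))"
    by (simp add: curve_integral_of_real sphere_integral_of_real scaleR_conv_of_real field_simps
        del: of_real_power)
  then show ?thesis
    by (simp only: of_real_eq_iff)
qed

section \<open>Surface measure of open sets\<close>

lemma sets_surface_measure:
  "sets (surface_measure :: 'a::euclidean_space measure) = sets (restrict_space borel (sphere 0 1))"
  by (simp add: surface_measure_def)

lemma finite_measure_surface_measure: "finite_measure (surface_measure :: 'a::euclidean_space measure)"
proof (rule finite_measureI)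
  have "emeasure lborel {x :: 'a. 0 < norm x \<and> norm x \<le> 1 \<and> x /\<^sub>R norm x \<in> sphere 0 1} \<le>
      emeasure lborel (cball 0 1 :: 'a set)"
    by (intro emeasure_mono) auto
  also have "\<dots> < \<infinity>"
    by (rule emeasure_bounded_finite) simp
  finally show "emeasure surface_measure (space (surface_measure :: 'a measure)) \<noteq> \<infinity>"
    by (subst space_surface_measure, subst emeasure_surface_measure)
       (auto simp: ennreal_mult_eq_top_iff of_nat_less_top)
qed

text \<open>The part of the open cone over \<open>U\<close> that lies in the punctured unit ball is open, and it
  contains \<open>x / 2\<close>; nonempty open sets have positive Lebesgue measure.\<close>

lemma emeasure_surface_measure_open_pos:
  fixes x :: "'a::euclidean_space"
  assumes "open U" "x \<in> U" "x \<in> sphere 0 1"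
  shows "emeasure surface_measure (sphere 0 1 \<inter> U) > 0"
proof -
  let ?C = "(ball 0 1 - {0 :: 'a}) \<inter> (\<lambda>y. y /\<^sub>R norm y) -` U"
  let ?D = "{y :: 'a. 0 < norm y \<and> norm y \<le> 1 \<and> y /\<^sub>R norm y \<in> sphere 0 1 \<inter> U}"
  have "open ?C"
    by (rule continuous_open_preimage) (auto intro!: continuous_intros assms)
  moreover have "x /\<^sub>R 2 \<in> ?C"
    using assms by auto
  ultimately have "\<not> negligible ?C"
    using open_not_negligible by blast
  with \<open>open ?C\<close> have C: "emeasure lborel ?C \<noteq> 0"
    by (auto simp: negligible_iff_null_sets null_sets_def)
  have "?D = (cball 0 1 - {0}) \<inter> (\<lambda>y. y /\<^sub>R norm y) -` U"
    by auto
  moreover have "(\<lambda>y :: 'a. y /\<^sub>R norm y) -` U \<in> sets borel"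
    using measurable_sets[of "\<lambda>y :: 'a. y /\<^sub>R norm y" borel borel U] assms(1) by simp
  ultimately have "?D \<in> sets lborel"
    by auto
  moreover have "?C \<subseteq> ?D"
    by auto
  ultimately have "emeasure lborel ?C \<le> emeasure lborel ?D"
    by (intro emeasure_mono)
  with C have "emeasure lborel ?D \<noteq> 0"
    by (metis le_zero_eq)
  then have "of_nat DIM('a) * emeasure lborel ?D \<noteq> 0"
    by simp
  then show ?thesis
    using assms(1) by (subst emeasure_surface_measure) (auto simp: zero_less_iff_neq_zero)
qed

lemma measure_surface_measure_pos:
  "measure surface_measure (sphere 0 1 :: 'a::euclidean_space set) > 0"
proof -
  interpret finite_measure "surface_measure :: 'a measure"
    by (rule finite_measure_surface_measure)
  obtain b :: 'a where "b \<in> Basis"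
    using nonempty_Basis by blast
  then have "emeasure surface_measure (sphere 0 1 \<inter> UNIV :: 'a set) > 0"
    by (intro emeasure_surface_measure_open_pos[where x = b]) auto
  then show ?thesis
    by (simp add: emeasure_eq_measure)
qed

lemma sphere_integral_eq_0_imp_eq_0:
  fixes h :: "'a::euclidean_space \<Rightarrow> real"
  assumes cont: "continuous_on UNIV h" and nonneg: "\<And>x. h x \<ge> 0"
    and int: "sphere_integral h = 0" and x: "x \<in> sphere 0 1"
  shows "h x = 0"
proof (rule ccontr)
  assume "h x \<noteq> 0"
  let ?M = "surface_measure :: 'a measure"
  interpret finite_measure ?M
    by (rule finite_measure_surface_measure)
  have meas: "h \<in> borel_measurable ?M"
    using borel_measurable_continuous_onI[OF cont]
    by (auto simp: measurable_cong_sets[OF sets_surface_measure refl]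
        intro: measurable_restrict_space1)
  have "bounded (h ` sphere 0 1)"
    by (intro compact_imp_bounded compact_continuous_image continuous_on_subset[OF cont]) auto
  then obtain B where "\<forall>z \<in> h ` sphere 0 1. norm z \<le> B"
    unfolding bounded_iff by blast
  then have "integrable ?M h"
    by (intro integrable_const_bound[where B = B] meas) (auto simp: space_surface_measure)
  moreover have "(LINT y|?M. h y) = 0"
    using int measure_surface_measure_pos[where 'a = 'a] by (simp add: sphere_integral_def)
  ultimately have "AE y in ?M. h y = 0"
    using integral_nonneg_eq_0_iff_AE[of ?M h] nonneg by simp
  moreover have "{y \<in> space ?M. h y \<noteq> 0} \<in> sets ?M"
    using meas by measurable
  ultimately have "emeasure ?M {y \<in> space ?M. h y \<noteq> 0} = 0"
    by (simp add: AE_iff_measurable[OF _ refl])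
  moreover have "{y \<in> space ?M. h y \<noteq> 0} = sphere 0 1 \<inter> {y. h y \<noteq> 0}"
    by (auto simp: space_surface_measure)
  moreover have "open {y. h y \<noteq> 0}"
    by (intro open_Collect_neq cont continuous_intros)
  ultimately show False
    using emeasure_surface_measure_open_pos[of "{y. h y \<noteq> 0}" x] \<open>h x \<noteq> 0\<close> x by simp
qed

section \<open>Exact quadrature of squares and unique determination\<close>

theorem corollary1p4:
  fixes d t :: nat and \<gamma> :: "real \<Rightarrow> real ^ 'n" and f :: "real ^ 'n \<Rightarrow> complex"
  assumes "CARD('n) = d + 1" and "d \<ge> 1" and "t \<ge> 1"
    and "design_curve (2 * t) \<gamma>"
    and "f \<in> poly_space t"
  shows "curve_integral \<gamma> (\<lambda>x. (cmod (f x))\<^sup>2) / curve_length \<gamma> = sphere_integral (\<lambda>x. (cmod (f x))\<^sup>2)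
    \<and> (\<forall>g \<in> poly_space t. (\<forall>x \<in> \<gamma> ` {0..1}. f x = g x) \<longrightarrow> (\<forall>x \<in> sphere 0 1. f x = g x))"
proof (intro conjI ballI impI)
  show "curve_integral \<gamma> (\<lambda>x. (cmod (f x))\<^sup>2) / curve_length \<gamma> = sphere_integral (\<lambda>x. (cmod (f x))\<^sup>2)"
    using assms by (intro design_curve_norm_square)
next
  fix g :: "real ^ 'n \<Rightarrow> complex" and x :: "real ^ 'n"
  assume g: "g \<in> poly_space t" and eq: "\<forall>x \<in> \<gamma> ` {0..1}. f x = g x" and x: "x \<in> sphere 0 1"
  let ?h = "\<lambda>x. f x - g x"
  have h: "?h \<in> poly_space t"
    using assms g by (intro poly_space_diff)
  have "curve_integral \<gamma> (\<lambda>x. (cmod (?h x))\<^sup>2) = integral {0..1 :: real} (\<lambda>s. 0)"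
    unfolding curve_integral_def
    by (rule Henstock_Kurzweil_Integration.integral_cong) (simp add: eq)
  then have "sphere_integral (\<lambda>x. (cmod (?h x))\<^sup>2) = 0"
    using design_curve_norm_square[OF assms(4) h] by simp
  then have "(cmod (?h x))\<^sup>2 = 0"
    using x by (intro sphere_integral_eq_0_imp_eq_0[where h = "\<lambda>x. (cmod (?h x))\<^sup>2"])
      (auto intro!: continuous_intros continuous_on_poly_space[OF g]
        continuous_on_poly_space[OF assms(5)])
  then show "f x = g x"
    by simp
qed

end
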